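(* Let $G=(V,E)$ be a graph containing exactly $k$ triangles, and let $m$ denote the number of vertices of $G$ that do not lie on any triangle. Then the $\Delta$-Radon number satisfies $r_\Delta(G)\leq m+2k$.
   Context: All graphs are finite, simple, undirected and connected. A triangle is a set of three pairwise adjacent vertices (a copy of $K_3$). For $S\subseteq V$, the $\Delta$-interval $[S]$ is the set consisting of all vertices of $S$ together with every vertex $v\in V$ that is adjacent to both $x$ and $y$ for some pair of adjacent vertices $x,y\in S$. A set $S$ is $\Delta$-convex if $[S]=S$. The $\Delta$-convex hull $\langle S\rangle$ is the smallest $\Delta$-convex set containing $S$ (note $\langle\emptyset\rangle=\emptyset$). A set $S\subseteq V$ is Radon dependent if there is a partition $\{S_1,S_2\}$ of $S$ (so $S_1\cup S_2=S$, $S_1\cap S_2=\emptyset$) with $\langle S_1\rangle\cap\langle S_2\rangle\neq\emptyset$, and Radon independent otherwise. The Radon number $r_\Delta(G)$ is the least integer $n\ge0$ such that every $S\subseteq V$ with $|S|>n$ is Radon dependent (equivalently, the maximum size of a Radon independent set). *)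

theory Defs
  imports "Graph_Theory.Digraph_Component"
begin

text \<open>
  Simple undirected graphs are the symmetric, loop-free digraphs without parallel arcs of the
  locale \<^locale>\<open>graph\<close>; adjacency of \<open>u\<close> and \<open>v\<close> is \<open>u \<rightarrow>\<^bsub>G\<^esub> v\<close>, which is then a symmetric,
  irreflexive relation on \<open>verts G\<close>.
\<close>

definition triangles :: "('a, 'b) pre_digraph \<Rightarrow> 'a set set" where
  "triangles G = {T. T \<subseteq> verts G \<and> card T = 3 \<and> (\<forall>x\<in>T. \<forall>y\<in>T. x \<noteq> y \<longrightarrow> x \<rightarrow>\<^bsub>G\<^esub> y)}"

definition delta_interval :: "('a, 'b) pre_digraph \<Rightarrow> 'a set \<Rightarrow> 'a set" where
  "delta_interval G S =
     S \<union> {v \<in> verts G. \<exists>x\<in>S. \<exists>y\<in>S. x \<rightarrow>\<^bsub>G\<^esub> y \<and> v \<rightarrow>\<^bsub>G\<^esub> x \<and> v \<rightarrow>\<^bsub>G\<^esub> y}"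

definition delta_convex :: "('a, 'b) pre_digraph \<Rightarrow> 'a set \<Rightarrow> bool" where
  "delta_convex G S \<longleftrightarrow> S \<subseteq> verts G \<and> delta_interval G S = S"

definition delta_hull :: "('a, 'b) pre_digraph \<Rightarrow> 'a set \<Rightarrow> 'a set" where
  "delta_hull G S = delta_convex G hull S"

text \<open>
  Empty parts of the partition are permitted; since the hull of the empty set is empty, they never
  witness Radon dependence.
\<close>

definition radon_dependent :: "('a, 'b) pre_digraph \<Rightarrow> 'a set \<Rightarrow> bool" where
  "radon_dependent G S \<longleftrightarrow>
     (\<exists>S\<^sub>1 S\<^sub>2. S\<^sub>1 \<union> S\<^sub>2 = S \<and> S\<^sub>1 \<inter> S\<^sub>2 = {} \<and> delta_hull G S\<^sub>1 \<inter> delta_hull G S\<^sub>2 \<noteq> {})"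

definition radon_number :: "('a, 'b) pre_digraph \<Rightarrow> nat" where
  "radon_number G = (LEAST n. \<forall>S \<subseteq> verts G. card S > n \<longrightarrow> radon_dependent G S)"

text \<open>The hull is the smallest \<open>\<Delta>\<close>-convex set containing a given set of vertices.\<close>

lemma delta_convex_verts: "delta_convex G (verts G)"
  unfolding delta_convex_def delta_interval_def by auto

lemma delta_convex_Inter:
  assumes "\<F> \<noteq> {}" and "\<And>S. S \<in> \<F> \<Longrightarrow> delta_convex G S"
  shows "delta_convex G (\<Inter>\<F>)"
  unfolding delta_convex_def
proof
  show "\<Inter>\<F> \<subseteq> verts G"
    using assms unfolding delta_convex_def by blast
  have "delta_interval G (\<Inter>\<F>) \<subseteq> delta_interval G S" if "S \<in> \<F>" for S
    using that unfolding delta_interval_def by blast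
  then have "delta_interval G (\<Inter>\<F>) \<subseteq> \<Inter>\<F>"
    using assms(2) unfolding delta_convex_def by blast
  then show "delta_interval G (\<Inter>\<F>) = \<Inter>\<F>"
    unfolding delta_interval_def by blast
qed

lemma delta_hull_convex: "S \<subseteq> verts G \<Longrightarrow> delta_convex G (delta_hull G S)"
  unfolding delta_hull_def hull_def
  by (rule delta_convex_Inter) (use delta_convex_verts in blast)+

lemma delta_hull_superset: "S \<subseteq> delta_hull G S"
  unfolding delta_hull_def by (rule hull_subset)

lemma delta_hull_minimal: "S \<subseteq> T \<Longrightarrow> delta_convex G T \<Longrightarrow> delta_hull G S \<subseteq> T"
  unfolding delta_hull_def by (rule hull_minimal)

lemma delta_hull_empty: "delta_hull G {} = {}"
  using delta_hull_minimal[of "{}" "{}" G]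
  by (simp add: delta_convex_def delta_interval_def)

text \<open>In a finite graph the set over which the minimum is taken is nonempty.\<close>

lemma (in fin_digraph) radon_number_dependent:
  assumes "S \<subseteq> verts G" and "card S > radon_number G"
  shows "radon_dependent G S"
proof -
  have "\<forall>S \<subseteq> verts G. card S > card (verts G) \<longrightarrow> radon_dependent G S"
    using card_mono[OF finite_verts] leD by blast
  then have "\<forall>S \<subseteq> verts G. card S > radon_number G \<longrightarrow> radon_dependent G S"
    unfolding radon_number_def by (rule LeastI)
  then show ?thesis using assms by blast
qed

end

theory Submission
  imports Defs
begin

text \<open>
  If \<open>S\<close> contains a triangle \<open>{a, b, c}\<close>, then \<open>c\<close> lies in the hulls of both \<open>{a, b}\<close> and
  \<open>S - {a, b}\<close>. So a Radon independent set meets each of the \<open>k\<close> triangles in at most two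
  vertices, and it has at most \<open>m\<close> vertices outside the triangles.
\<close>

lemma radon_dependent_triangle_subset:
  assumes T: "T \<in> triangles G" and TS: "T \<subseteq> S"
  shows "radon_dependent G S"
proof -
  obtain a b c where abc: "T = {a, b, c}" "a \<noteq> b" "a \<noteq> c" "b \<noteq> c"
    using T unfolding triangles_def by (auto simp: card_3_iff)
  have V: "{a, b, c} \<subseteq> verts G" and adj: "a \<rightarrow>\<^bsub>G\<^esub> b" "c \<rightarrow>\<^bsub>G\<^esub> a" "c \<rightarrow>\<^bsub>G\<^esub> b"
    using T abc unfolding triangles_def by auto
  have "{a, b} \<subseteq> delta_hull G {a, b}"
    by (rule delta_hull_superset)
  \<comment> \<open>As \<open>a\<close> and \<open>b\<close> are adjacent, one interval step adds
    their common neighbour \<open>c\<close>, and the hull is closed under such steps.\<close>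
  then have "c \<in> delta_interval G (delta_hull G {a, b})"
    using V adj unfolding delta_interval_def by blast
  then have "c \<in> delta_hull G {a, b}"
    using delta_hull_convex[of "{a, b}" G] V unfolding delta_convex_def by simp
  moreover have "c \<in> delta_hull G (S - {a, b})"
    using delta_hull_superset[of "S - {a, b}" G] abc TS by blast
  moreover have "{a, b} \<union> (S - {a, b}) = S" "{a, b} \<inter> (S - {a, b}) = {}"
    using abc TS by auto
  ultimately show ?thesis
    unfolding radon_dependent_def by blast
qed

lemma card_Int_triangle_le_2:
  assumes "T \<in> triangles G" and "\<not> radon_dependent G S"
  shows "card (S \<inter> T) \<le> 2"
proof -
  have "card T = 3"
    using assms(1) unfolding triangles_def by simp
  \<comment> \<open>Infinite sets have cardinality 0 by convention, so cardinality 3 forces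
    finiteness.\<close>
  moreover from this have "finite T"
    by (simp add: card_ge_0_finite)
  \<comment> \<open>Equality would put the whole triangle inside \<open>S\<close>, making
    \<open>S\<close> Radon dependent.\<close>
  moreover have "S \<inter> T \<subset> T"
    using radon_dependent_triangle_subset assms by blast
  ultimately show ?thesis
    using psubset_card_mono[of T "S \<inter> T"] by simp
qed

lemma (in fin_digraph) finite_triangles: "finite (triangles G)"
  by (rule finite_subset[of _ "Pow (verts G)"]) (auto simp: triangles_def)

lemma (in fin_digraph) card_radon_independent_le:
  assumes S: "S \<subseteq> verts G" and indep: "\<not> radon_dependent G S"
  shows "card S \<le> card {v \<in> verts G. \<forall>T \<in> triangles G. v \<notin> T} + 2 * card (triangles G)"
proof -
  let ?M = "{v \<in> verts G. \<forall>T \<in> triangles G. v \<notin> T}"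
  let ?U = "\<Union>T\<in>triangles G. S \<inter> T"
  have "finite ?U"
    using S finite_verts by (auto intro: finite_subset)
  moreover have "S \<subseteq> ?M \<union> ?U"
    using S by blast
  ultimately have "card S \<le> card (?M \<union> ?U)"
    by (intro card_mono) auto
  also have "\<dots> \<le> card ?M + card ?U"
    by (rule card_Un_le)
  \<comment> \<open>Triangles may overlap; the sum counts a shared vertex once per triangle, hence
    only an inequality.\<close>
  also have "card ?U \<le> (\<Sum>T\<in>triangles G. card (S \<inter> T))"
    by (rule card_UN_le[OF finite_triangles])
  also have "\<dots> \<le> 2 * card (triangles G)"
    using sum_bounded_above[of "triangles G" "\<lambda>T. card (S \<inter> T)" 2]
      card_Int_triangle_le_2[OF _ indep] by (simp add: mult.commute)
  finally show ?thesis by simp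
qed

theorem theorem4:
  fixes G :: "('a, 'b) pre_digraph" and k m :: nat
  assumes "graph G" and "Digraph_Component.connected G"
    and "card (triangles G) = k"
    and "card {v \<in> verts G. \<forall>T \<in> triangles G. v \<notin> T} = m"
  shows "radon_number G \<le> m + 2 * k"
proof -
  interpret graph G by (rule assms(1))
  \<comment> \<open>By contraposition of the bound for independent sets, \<open>m + 2 * k\<close> is
    among the numbers whose least is \<open>radon_number G\<close>.\<close>
  have "\<forall>S \<subseteq> verts G. card S > m + 2 * k \<longrightarrow> radon_dependent G S"
    using card_radon_independent_le assms(3,4) by (metis leD)
  then show ?thesis
    unfolding radon_number_def by (rule Least_le)
qed

end
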